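(* Let $p$ be a prime, $\tau\in\mathfrak{H}$, $\alpha_0\in S^{-1}\mathbb{Z}^m$, $X=(x,X_0,x')\in\mathbb{R}^{m+2}$ and $Y=(y,Y_0,y')\in\mathcal{Y}$. For $c,d\in\mathbb{Z}$: (i) if $p\nmid c$ or $p\nmid d$, then $I^{\uparrow}_-(c,d)=I^{\downarrow}_-(c,d)$; (ii) if $p\mid c$ and $p\mid d$, then $I^{\uparrow}_-(c,d)=p\,I^{\downarrow}_+(c/p,d/p)$ and $I^{\downarrow}_-(c,d)=p\,I^{\uparrow}_+(c/p,d/p)$.
   Context: Let $m\ge0$ and $S$ a positive definite even integral symmetric $m\times m$ matrix; write $S(u,v)={}^tuSv$, $S[u]=S(u,u)$. On $\mathbb{C}^{m+2}$, elements written $(x_1,x_2,x_3)$ with $x_1,x_3\in\mathbb{C}$, $x_2\in\mathbb{C}^m$, let $Q_1((x_1,x_2,x_3),(y_1,y_2,y_3))=x_1y_3+x_3y_1-S(x_2,y_2)$ and $Q_1[X]=Q_1(X,X)$. Let $L_1=\mathbb{Z}^{m+2}$, $L_0=\mathbb{Z}^m$, $\alpha_1=(0,\alpha_0,0)$, and $\mathcal{Y}=\{Y=(y,Y_0,y')\in\mathbb{R}^{m+2}:Q_1[Y]>0,\ y>0\}$. Let $e(x)=\exp(2\pi ix)$. For $\tau\in\mathfrak{H}$, $Y\in\mathcal{Y}$, $r,t\in\mathbb{R}^{m+2}$, define \[ \theta_{\alpha_1}(\tau,Y;r,t)=\sum_{\lambda\in\alpha_1+L_1}e\left(i\,\mathrm{Im}(\tau)\frac{Q_1(\lambda+t,Y)^2}{Q_1[Y]}+\frac{\bar\tau}{2}Q_1[\lambda+t]-Q_1\left(\lambda+\frac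 t2,r\right)\right). \] For $a\in\mathbb{Z}$ put $X^\uparrow_+=(px,\sqrt pX_0,x')$, $Y^\uparrow_+=(py,\sqrt pY_0,y')$, $X^\uparrow_-(a)=(p^{-1}(x+a),p^{-1/2}X_0,x')$, $Y^\uparrow_-=(p^{-1}y,p^{-1/2}Y_0,y')$, $X^\downarrow_+=(x,\sqrt pX_0,px')$, $Y^\downarrow_+=(y,\sqrt pY_0,py')$, $X^\downarrow_-(a)=(x,p^{-1/2}X_0,p^{-1}(x'+a))$, $Y^\downarrow_-=(y,p^{-1/2}Y_0,p^{-1}y')$. For $c,d\in\mathbb{Z}$ set $I^\uparrow_+(c,d)=\theta_{\alpha_1}(\tau,Y^\uparrow_+;dX^\uparrow_+,-cX^\uparrow_+)$, $I^\uparrow_-(c,d)=\sum_{a=0}^{p-1}\theta_{\alpha_1}(\tau,Y^\uparrow_-;dX^\uparrow_-(a),-cX^\uparrow_-(a))$, $I^\downarrow_+(c,d)=\theta_{\alpha_1}(\tau,Y^\downarrow_+;dX^\downarrow_+,-cX^\downarrow_+)$, $I^\downarrow_-(c,d)=\sum_{a=0}^{p-1}\theta_{\alpha_1}(\tau,Y^\downarrow_-;dX^\downarrow_-(a),-cX^\downarrow_-(a))$. *)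

theory Defs
  imports
    "Jordan_Normal_Form.Matrix"
    "HOL-Analysis.Infinite_Sum"
    "HOL-Library.Product_Plus"
    "HOL-Computational_Algebra.Primes"
begin

text \<open>
  Vectors and matrices with explicit dimension are used so that the rank \<open>m = 0\<close> is allowed.
  The space \<open>\<real>\<^bsup>m+2\<^esup>\<close> is represented by triples \<open>(x\<^sub>1, x\<^sub>2, x\<^sub>3)\<close> whose middle component
  lies in \<open>carrier_vec m\<close>; addition of triples is componentwise.
\<close>

type_synonym triple = "real \<times> real vec \<times> real"

definition sform :: "real mat \<Rightarrow> real vec \<Rightarrow> real vec \<Rightarrow> real" where
  "sform S u v = scalar_prod u (S *\<^sub>v v)"

definition int_vecs :: "nat \<Rightarrow> real vec set" where
  "int_vecs m = {v \<in> carrier_vec m. \<forall>i<m. vec_index v i \<in> \<int>}"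

definition pos_def_even_integral :: "nat \<Rightarrow> real mat \<Rightarrow> bool" where
  "pos_def_even_integral m S \<longleftrightarrow>
     S \<in> carrier_mat m m \<and> transpose_mat S = S \<and>
     (\<forall>i<m. \<forall>j<m. S $$ (i, j) \<in> \<int>) \<and>
     (\<forall>i<m. \<exists>k::int. S $$ (i, i) = 2 * of_int k) \<and>
     (\<forall>u \<in> carrier_vec m. u \<noteq> 0\<^sub>v m \<longrightarrow> sform S u u > 0)"

definition S_inv_int_vecs :: "nat \<Rightarrow> real mat \<Rightarrow> real vec set" where
  "S_inv_int_vecs m S =
     {T *\<^sub>v z | T z. T \<in> carrier_mat m m \<and> inverts_mat S T \<and> inverts_mat T S \<and> z \<in> int_vecs m}"

definition triples :: "nat \<Rightarrow> triple set" where
  "triples m = UNIV \<times> carrier_vec m \<times> UNIV"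

definition L1 :: "nat \<Rightarrow> triple set" where
  "L1 m = \<int> \<times> int_vecs m \<times> \<int>"

definition tscale :: "real \<Rightarrow> triple \<Rightarrow> triple" where
  "tscale k = (\<lambda>(x1, x2, x3). (k * x1, k \<cdot>\<^sub>v x2, k * x3))"

definition Q1 :: "real mat \<Rightarrow> triple \<Rightarrow> triple \<Rightarrow> real" where
  "Q1 S = (\<lambda>(x1, x2, x3) (y1, y2, y3). x1 * y3 + x3 * y1 - sform S x2 y2)"

definition Ycone :: "nat \<Rightarrow> real mat \<Rightarrow> triple set" where
  "Ycone m S = {Y \<in> triples m. Q1 S Y Y > 0 \<and> fst Y > 0}"

definition ee :: "complex \<Rightarrow> complex" where
  "ee x = exp (2 * of_real pi * \<i> * x)"

text \<open>
  For \<open>Im \<tau> > 0\<close> and \<open>Y\<close> in the cone the series converges absolutely (the form \<open>Q1\<close> has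
  signature \<open>(1, m + 1)\<close>), so the default value of \<open>infsum\<close> is not used there.
\<close>

definition theta ::
  "nat \<Rightarrow> real mat \<Rightarrow> real vec \<Rightarrow> complex \<Rightarrow> triple \<Rightarrow> triple \<Rightarrow> triple \<Rightarrow> complex" where
  "theta m S \<alpha>0 \<tau> Y r t =
     (\<Sum>\<^sub>\<infinity>v \<in> (\<lambda>l. (0, \<alpha>0, 0) + l) ` L1 m.
        ee (\<i> * of_real (Im \<tau>) * of_real ((Q1 S (v + t) Y)\<^sup>2 / Q1 S Y Y)
           + cnj \<tau> / 2 * of_real (Q1 S (v + t) (v + t))
           - of_real (Q1 S (v + tscale (1/2) t) r)))"

text \<open>
  The rescalings of \<open>X\<close>; those of \<open>Y\<close> are given by the same formulas, with \<open>a = 0\<close> for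
  the two minus operators.
\<close>

definition up_plus :: "nat \<Rightarrow> triple \<Rightarrow> triple" where
  "up_plus p = (\<lambda>(x, X0, x'). (p * x, sqrt p \<cdot>\<^sub>v X0, x'))"

definition up_minus :: "nat \<Rightarrow> int \<Rightarrow> triple \<Rightarrow> triple" where
  "up_minus p a = (\<lambda>(x, X0, x'). ((x + a) / p, (1 / sqrt p) \<cdot>\<^sub>v X0, x'))"

definition down_plus :: "nat \<Rightarrow> triple \<Rightarrow> triple" where
  "down_plus p = (\<lambda>(x, X0, x'). (x, sqrt p \<cdot>\<^sub>v X0, p * x'))"

definition down_minus :: "nat \<Rightarrow> int \<Rightarrow> triple \<Rightarrow> triple" where
  "down_minus p a = (\<lambda>(x, X0, x'). (x, (1 / sqrt p) \<cdot>\<^sub>v X0, (x' + a) / p))"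

definition I_up_plus ::
  "nat \<Rightarrow> real mat \<Rightarrow> real vec \<Rightarrow> nat \<Rightarrow> complex \<Rightarrow> triple \<Rightarrow> triple \<Rightarrow> int \<Rightarrow> int \<Rightarrow> complex" where
  "I_up_plus m S \<alpha>0 p \<tau> X Y c d =
     theta m S \<alpha>0 \<tau> (up_plus p Y)
       (tscale (of_int d) (up_plus p X)) (tscale (- of_int c) (up_plus p X))"

definition I_up_minus ::
  "nat \<Rightarrow> real mat \<Rightarrow> real vec \<Rightarrow> nat \<Rightarrow> complex \<Rightarrow> triple \<Rightarrow> triple \<Rightarrow> int \<Rightarrow> int \<Rightarrow> complex" where
  "I_up_minus m S \<alpha>0 p \<tau> X Y c d =
     (\<Sum>a = 0..int p - 1. theta m S \<alpha>0 \<tau> (up_minus p 0 Y)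
       (tscale (of_int d) (up_minus p a X)) (tscale (- of_int c) (up_minus p a X)))"

definition I_down_plus ::
  "nat \<Rightarrow> real mat \<Rightarrow> real vec \<Rightarrow> nat \<Rightarrow> complex \<Rightarrow> triple \<Rightarrow> triple \<Rightarrow> int \<Rightarrow> int \<Rightarrow> complex" where
  "I_down_plus m S \<alpha>0 p \<tau> X Y c d =
     theta m S \<alpha>0 \<tau> (down_plus p Y)
       (tscale (of_int d) (down_plus p X)) (tscale (- of_int c) (down_plus p X))"

definition I_down_minus ::
  "nat \<Rightarrow> real mat \<Rightarrow> real vec \<Rightarrow> nat \<Rightarrow> complex \<Rightarrow> triple \<Rightarrow> triple \<Rightarrow> int \<Rightarrow> int \<Rightarrow> complex" where
  "I_down_minus m S \<alpha>0 p \<tau> X Y c d =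
     (\<Sum>a = 0..int p - 1. theta m S \<alpha>0 \<tau> (down_minus p 0 Y)
       (tscale (of_int d) (down_minus p a X)) (tscale (- of_int c) (down_minus p a X)))"

end

theory Submission
  imports Defs "HOL-Number_Theory.Cong"
begin

text \<open>
  Write \<open>n\<^sub>1 = p l\<^sub>1 - c a\<close>. Since \<open>(x\<^sub>1, x\<^sub>2, x\<^sub>3) \<mapsto> (x\<^sub>1 / p, x\<^sub>2 / sqrt p, x\<^sub>3)\<close> multiplies \<open>Q1\<close> by
  \<open>1 / p\<close>, the summand of the \<open>a\<close>-th theta series in \<open>I_up_minus\<close> is \<open>H(n\<^sub>1, l, l\<^sub>3) e(- d a l\<^sub>3 / p)\<close>
  with \<open>H\<close> independent of \<open>a\<close>. Exchanging the outer two coordinates turns up into down and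
  exchanges \<open>n\<^sub>1\<close> and \<open>n\<^sub>3\<close> in \<open>H\<close>, so it remains to sum over \<open>a\<close>.
  If \<open>p\<close> does not divide \<open>c\<close>, with \<open>c c' \<equiv> 1\<close> modulo \<open>p\<close>, the result is the sum of
  \<open>H(n\<^sub>1, l, n\<^sub>3) e(d c' n\<^sub>1 n\<^sub>3 / p)\<close>; if \<open>p\<close> divides \<open>c\<close>, orthogonality of characters gives \<open>p\<close> times
  the sum of \<open>H(p l\<^sub>1, l, l\<^sub>3)\<close> over \<open>p dvd d l\<^sub>3\<close>. Unless \<open>p\<close> divides both \<open>c\<close> and \<open>d\<close>, both are
  symmetric under the exchange; otherwise the latter is \<open>p\<close> times \<open>I_down_plus\<close>. Rearranging the
  series is justified by positivity of the majorant of \<open>Q1\<close> attached to \<open>Y\<close>.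
\<close>

section \<open>The majorant of the quadratic form\<close>

lemma sform_add_left:
  assumes "S \<in> carrier_mat m m" "u \<in> carrier_vec m" "v \<in> carrier_vec m" "w \<in> carrier_vec m"
  shows "sform S (u + v) w = sform S u w + sform S v w"
  using assms unfolding sform_def by (intro add_scalar_prod_distrib[where n = m]) auto

lemma sform_smult_left:
  assumes "S \<in> carrier_mat m m" "u \<in> carrier_vec m" "w \<in> carrier_vec m"
  shows "sform S (k \<cdot>\<^sub>v u) w = k * sform S u w"
  using assms unfolding sform_def by (intro smult_scalar_prod_distrib[where n = m]) auto

lemma sform_commute:
  assumes "S \<in> carrier_mat m m" "transpose_mat S = S" "u \<in> carrier_vec m" "v \<in> carrier_vec m"
  shows "sform S u v = sform S v u"
proof -
  have "sform S u v = (transpose_mat S *\<^sub>v u) \<bullet> v"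
    using assms unfolding sform_def by (metis transpose_vec_mult_scalar)
  also have "\<dots> = sform S v u"
    using assms unfolding sform_def by (metis comm_scalar_prod mult_mat_vec_carrier)
  finally show ?thesis .
qed

lemma mem_triples_iff [simp]: "(a, v, b) \<in> triples m \<longleftrightarrow> v \<in> carrier_vec m"
  by (simp add: triples_def)

lemma tscale_triples [simp]: "u \<in> triples m \<Longrightarrow> tscale k u \<in> triples m"
  by (cases u) (simp add: tscale_def)

lemma add_triples [simp]: "u \<in> triples m \<Longrightarrow> v \<in> triples m \<Longrightarrow> u + v \<in> triples m"
  by (cases u; cases v) simp

lemma Q1_add_left:
  assumes "S \<in> carrier_mat m m" "u \<in> triples m" "v \<in> triples m" "w \<in> triples m"
  shows "Q1 S (u + v) w = Q1 S u w + Q1 S v w"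
  using assms by (cases u; cases v; cases w) (simp add: Q1_def sform_add_left algebra_simps)

lemma Q1_tscale_left:
  assumes "S \<in> carrier_mat m m" "u \<in> triples m" "w \<in> triples m"
  shows "Q1 S (tscale k u) w = k * Q1 S u w"
  using assms by (cases u; cases w) (simp add: Q1_def tscale_def sform_smult_left algebra_simps)

lemma Q1_commute:
  assumes "S \<in> carrier_mat m m" "transpose_mat S = S" "u \<in> triples m" "w \<in> triples m"
  shows "Q1 S u w = Q1 S w u"
  using assms sform_commute[OF assms(1,2), of "fst (snd u)" "fst (snd w)"]
  by (cases u; cases w) (simp add: Q1_def)

lemma Q1_add_right:
  assumes "S \<in> carrier_mat m m" "transpose_mat S = S"
    and "u \<in> triples m" "v \<in> triples m" "w \<in> triples m"
  shows "Q1 S w (u + v) = Q1 S w u + Q1 S w v"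
  using assms by (simp add: Q1_commute[OF assms(1,2), of w] Q1_add_left)

lemma Q1_tscale_right:
  assumes "S \<in> carrier_mat m m" "transpose_mat S = S" "u \<in> triples m" "w \<in> triples m"
  shows "Q1 S w (tscale k u) = k * Q1 S w u"
  using assms by (simp add: Q1_commute[OF assms(1,2), of w] Q1_tscale_left)

lemma pos_def_even_integralD:
  assumes "pos_def_even_integral m S"
  shows "S \<in> carrier_mat m m" "transpose_mat S = S"
  using assms by (auto simp: pos_def_even_integral_def)

lemma sform_nonneg:
  assumes "pos_def_even_integral m S" "u \<in> carrier_vec m"
  shows "sform S u u \<ge> 0"
proof (cases "u = 0\<^sub>v m")
  case True
  have "S *\<^sub>v u \<in> carrier_vec m"
    using assms pos_def_even_integralD by fastforce
  with True show ?thesis by (simp add: sform_def)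
next
  case False
  then show ?thesis using assms by (force simp: pos_def_even_integral_def)
qed

text \<open>Subtracting from \<open>v\<close> the multiple of \<open>Y\<close> with the same first coordinate leaves a vector
  on which \<open>Q1\<close> is \<open>- S\<close>; expanding \<open>Q1\<close> of that difference gives the inequality.\<close>

lemma Q1_reverse_Cauchy_Schwarz:
  assumes S: "pos_def_even_integral m S" and Y: "Y \<in> Ycone m S" and v: "v \<in> triples m"
  shows "Q1 S v v * Q1 S Y Y \<le> (Q1 S v Y)\<^sup>2"
proof -
  note S' = pos_def_even_integralD[OF S]
  have Yt: "Y \<in> triples m" and Q: "Q1 S Y Y > 0" and y: "fst Y > 0"
    using Y by (auto simp: Ycone_def)
  define s where "s = fst v / fst Y"
  define w where "w = v + tscale (- s) Y"
  have wt: "w \<in> triples m" using v Yt by (simp add: w_def)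
  have "fst w = 0" using y by (cases v; cases Y) (simp add: w_def s_def tscale_def)
  then have "Q1 S w w \<le> 0"
    using wt sform_nonneg[OF S] by (cases w) (auto simp: Q1_def)
  also have "Q1 S w w = Q1 S v v - 2 * s * Q1 S v Y + s\<^sup>2 * Q1 S Y Y"
    using S' v Yt Q1_commute[OF S' Yt v]
    by (simp add: w_def Q1_add_left Q1_add_right Q1_tscale_left Q1_tscale_right algebra_simps power2_eq_square)
  finally have "Q1 S v v \<le> 2 * s * Q1 S v Y - s\<^sup>2 * Q1 S Y Y" by simp
  then have "Q1 S v v * Q1 S Y Y \<le> (2 * s * Q1 S v Y - s\<^sup>2 * Q1 S Y Y) * Q1 S Y Y"
    using Q by (intro mult_right_mono) auto
  also have "\<dots> = (Q1 S v Y)\<^sup>2 - (Q1 S v Y - s * Q1 S Y Y)\<^sup>2"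
    by (simp add: algebra_simps power2_eq_square)
  also have "\<dots> \<le> (Q1 S v Y)\<^sup>2" by simp
  finally show ?thesis .
qed

text \<open>For \<open>Y\<close> in the cone this is the positive majorant of \<open>Q1\<close>: it
  agrees with \<open>Q1\<close> on the line through \<open>Y\<close> and with \<open>- Q1\<close> on
  the orthogonal complement of \<open>Y\<close>. It governs the Gaussian decay of the absolute
  values of the theta summands.\<close>

definition majorant :: "real mat \<Rightarrow> triple \<Rightarrow> triple \<Rightarrow> real" where
  "majorant S Y v = 2 * ((Q1 S v Y)\<^sup>2 / Q1 S Y Y) - Q1 S v v"

lemma majorant_nonneg:
  assumes S: "pos_def_even_integral m S" and Y: "Y \<in> Ycone m S" and v: "v \<in> triples m"
  shows "majorant S Y v \<ge> 0"
proof -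
  have "Q1 S Y Y > 0" using Y by (auto simp: Ycone_def)
  then have "Q1 S v v \<le> (Q1 S v Y)\<^sup>2 / Q1 S Y Y"
    using Q1_reverse_Cauchy_Schwarz[OF assms] by (simp add: field_simps)
  moreover have "0 \<le> (Q1 S v Y)\<^sup>2 / Q1 S Y Y"
    using \<open>Q1 S Y Y > 0\<close> by simp
  ultimately show ?thesis unfolding majorant_def by linarith
qed

text \<open>Pairing with \<open>w\<close> under \<open>Q1\<close> is pairing with the reflection \<open>w'\<close> of \<open>w\<close> under the majorant,
  so this is the Cauchy-Schwarz inequality for the majorant.\<close>

lemma Q1_le_majorant:
  assumes S: "pos_def_even_integral m S" and Y: "Y \<in> Ycone m S" and w: "w \<in> triples m"
  obtains C where "C > 0" "\<And>v. v \<in> triples m \<Longrightarrow> (Q1 S v w)\<^sup>2 \<le> C * majorant S Y v"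
proof -
  note S' = pos_def_even_integralD[OF S]
  have Yt: "Y \<in> triples m" and Q: "Q1 S Y Y > 0"
    using Y by (auto simp: Ycone_def)
  define w' where "w' = tscale (2 * Q1 S w Y / Q1 S Y Y) Y + tscale (-1) w"
  have w't: "w' \<in> triples m" using w Yt by (simp add: w'_def)
  \<comment> \<open>Adding 1 makes \<open>C\<close> positive although so far the majorant is only
    known to be semidefinite.\<close>
  define C where "C = majorant S Y w' + 1"
  have C: "C > 0" using majorant_nonneg[OF S Y w't] by (simp add: C_def)
  show thesis
  proof (rule that[OF C])
    fix v assume v: "v \<in> triples m"
    define q where "q = Q1 S v w"
    \<comment> \<open>This \<open>s\<close> minimises \<open>2 * s * q + s\<^sup>2 * C\<close>, the
      minimum being \<open>- q\<^sup>2 / C\<close>.\<close>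
    define s where "s = - q / C"
    have expand: "majorant S Y (v + tscale s w') = majorant S Y v + 2 * s * q + s\<^sup>2 * majorant S Y w'"
    proof -
      have 1: "Q1 S w' Y = Q1 S w Y"
        using S' w Yt Q by (simp add: w'_def Q1_add_left Q1_tscale_left)
      have 2: "Q1 S v w' = 2 * Q1 S w Y * Q1 S v Y / Q1 S Y Y - q"
        using S' v w Yt by (simp add: w'_def q_def Q1_add_right Q1_tscale_right)
      have 3: "Q1 S w' v = Q1 S v w'" using Q1_commute[OF S' w't v] .
      have 4: "Q1 S (v + tscale s w') Y = Q1 S v Y + s * Q1 S w Y"
        using S' v w't Yt by (simp add: Q1_add_left Q1_tscale_left 1)
      have 5: "Q1 S (v + tscale s w') (v + tscale s w')
          = Q1 S v v + 2 * s * Q1 S v w' + s\<^sup>2 * Q1 S w' w'"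
        using S' v w't 3
        by (simp add: Q1_add_left Q1_add_right Q1_tscale_left Q1_tscale_right algebra_simps power2_eq_square)
      show ?thesis unfolding majorant_def 4 5 1 2 using Q
        by (simp add: field_simps power2_eq_square)
    qed
    have "0 \<le> majorant S Y (v + tscale s w')"
      using v w't by (intro majorant_nonneg[OF S Y]) simp
    also have "\<dots> \<le> majorant S Y v + 2 * s * q + s\<^sup>2 * C"
      unfolding expand by (simp add: C_def distrib_left)
    also have "\<dots> = majorant S Y v - q\<^sup>2 / C"
      using C by (simp add: s_def field_simps power2_eq_square)
    finally show "(Q1 S v w)\<^sup>2 \<le> C * majorant S Y v"
      using C by (simp add: q_def field_simps)
  qed
qed

text \<open>Up to sign, each coordinate of a triple is its \<open>Q1\<close> pairing with a fixed
  triple: \<open>(0, 0\<^sub>v m, 1)\<close> gives the first, \<open>(1, 0\<^sub>v m, 0)\<close> the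
  last, and \<open>T\<close> applied to unit vectors gives the middle ones. So
  \<open>Q1_le_majorant\<close> bounds every square, and the constants add up. This makes the
  majorant definite.\<close>

lemma triple_norm_le_majorant:
  assumes S: "pos_def_even_integral m S" and Y: "Y \<in> Ycone m S"
    and T: "T \<in> carrier_mat m m" "inverts_mat S T"
  obtains C where "C > 0"
    "\<And>a u b. u \<in> carrier_vec m \<Longrightarrow> a\<^sup>2 + (\<Sum>i<m. (u $ i)\<^sup>2) + b\<^sup>2 \<le> C * majorant S Y (a, u, b)"
proof -
  note S' = pos_def_even_integralD[OF S]
  have ST: "S *\<^sub>v (T *\<^sub>v unit_vec m i) = unit_vec m i" for i
    using S' T by (metis assoc_mult_mat_vec carrier_matD(1) inverts_mat_def one_mult_mat_vec unit_vec_carrier)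
  have zero: "sform S u (0\<^sub>v m) = 0" if "u \<in> carrier_vec m" for u
  proof -
    have "S *\<^sub>v 0\<^sub>v m = 0\<^sub>v m" using S' by auto
    then show ?thesis using that by (simp add: sform_def)
  qed
  obtain A where A: "A > 0" "\<And>v. v \<in> triples m \<Longrightarrow> (Q1 S v (0, 0\<^sub>v m, 1))\<^sup>2 \<le> A * majorant S Y v"
    using Q1_le_majorant[OF S Y, of "(0, 0\<^sub>v m, 1)"] by auto
  obtain B where B: "B > 0" "\<And>v. v \<in> triples m \<Longrightarrow> (Q1 S v (1, 0\<^sub>v m, 0))\<^sup>2 \<le> B * majorant S Y v"
    using Q1_le_majorant[OF S Y, of "(1, 0\<^sub>v m, 0)"] by auto
  have "\<exists>C>0. \<forall>v\<in>triples m. (Q1 S v (0, T *\<^sub>v unit_vec m i, 0))\<^sup>2 \<le> C * majorant S Y v" for i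
  proof -
    have t: "(0, T *\<^sub>v unit_vec m i, 0) \<in> triples m" using T by simp
    show ?thesis by (rule Q1_le_majorant[OF S Y t]) blast
  qed
  then obtain C where C: "\<And>i. C i > 0"
    "\<And>i v. v \<in> triples m \<Longrightarrow> (Q1 S v (0, T *\<^sub>v unit_vec m i, 0))\<^sup>2 \<le> C i * majorant S Y v"
    by metis
  show thesis
  proof
    show "A + (\<Sum>i<m. C i) + B > 0"
      using A B C by (simp add: add_pos_nonneg add_nonneg_pos sum_nonneg less_imp_le)
  next
    fix a b and u :: "real vec" assume u: "u \<in> carrier_vec m"
    have "(u $ i)\<^sup>2 \<le> C i * majorant S Y (a, u, b)" if "i < m" for i
      using C(2)[of "(a, u, b)" i] u that by (simp add: Q1_def sform_def ST)
    moreover have "a\<^sup>2 \<le> A * majorant S Y (a, u, b)" "b\<^sup>2 \<le> B * majorant S Y (a, u, b)"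
      using A(2)[of "(a, u, b)"] B(2)[of "(a, u, b)"] u by (simp_all add: Q1_def zero)
    ultimately show "a\<^sup>2 + (\<Sum>i<m. (u $ i)\<^sup>2) + b\<^sup>2 \<le> (A + (\<Sum>i<m. C i) + B) * majorant S Y (a, u, b)"
      unfolding distrib_right sum_distrib_right by (intro add_mono sum_mono) auto
  qed
qed

section \<open>Summability over integer vectors\<close>

text \<open>The integers are split by sign; the negative half starts at 1 so that 0 is covered only
  once.\<close>

lemma summable_on_UNIV_int:
  fixes f :: "int \<Rightarrow> 'a :: {comm_monoid_add,topological_comm_monoid_add}"
  assumes "(\<lambda>n. f (int n)) summable_on UNIV" "(\<lambda>n. f (- int n)) summable_on {1..}"
  shows "f summable_on UNIV"
proof -
  have "f summable_on range int"
    using assms(1) by (subst summable_on_reindex) (auto simp: o_def)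
  moreover have "f summable_on (\<lambda>n. - int n) ` {1..}"
    using assms(2) by (subst summable_on_reindex) (auto simp: o_def inj_on_def)
  moreover have "range int \<inter> (\<lambda>n. - int n) ` {1..} = {}" by auto
  moreover have "range int \<union> (\<lambda>n. - int n) ` {1..} = UNIV"
  proof -
    have "k \<in> range int \<union> (\<lambda>n. - int n) ` {1..}" for k
    proof (cases "k \<ge> 0")
      case True
      then show ?thesis by (metis UnI1 nonneg_int_cases rangeI)
    next
      case False
      then have "k = - int (nat (- k))" "nat (- k) \<in> {1..}" by auto
      then show ?thesis by blast
    qed
    then show ?thesis by blast
  qed
  ultimately show ?thesis by (metis summable_on_Un_disjoint)
qed

lemma summable_on_exp_abs_int:
  fixes k :: real
  assumes "k > 0"
  shows "(\<lambda>n::int. exp (- k * \<bar>of_int n\<bar>)) summable_on UNIV"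
proof (rule summable_on_UNIV_int)
  have "summable (\<lambda>n. exp (- k) ^ n)"
    using assms by (intro summable_geometric) auto
  then have "summable (\<lambda>n. norm (exp (- k) ^ n))" by simp
  then have "(\<lambda>n. exp (- k) ^ n) summable_on UNIV"
    by (rule norm_summable_imp_summable_on)
  then have *: "(\<lambda>n. exp (- (k * real n))) summable_on UNIV"
    by (simp add: exp_of_nat_mult [symmetric] mult.commute)
  then show "(\<lambda>n. exp (- k * \<bar>of_int (int n)\<bar>)) summable_on UNIV" by simp
  show "(\<lambda>n. exp (- k * \<bar>of_int (- int n)\<bar>)) summable_on {1..}"
    using summable_on_subset_banach[OF *, of "{1..}"] by simp
qed

text \<open>The bound \<open>\<bar>x\<bar> \<le> 1 + x\<^sup>2\<close> dominates the Gaussian by a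
  two-sided exponential; the shift \<open>b\<close> only enters the constant factor.\<close>

lemma summable_on_gaussian_int:
  fixes k q b :: real
  assumes "k > 0" "q \<noteq> 0"
  shows "(\<lambda>n::int. exp (- k * (q * of_int n + b)\<^sup>2)) summable_on UNIV"
proof -
  have "(\<lambda>n::int. exp (k * (1 + \<bar>b\<bar>)) * exp (- (k * \<bar>q\<bar>) * \<bar>of_int n\<bar>)) summable_on UNIV"
    using assms by (intro summable_on_cmult_right summable_on_exp_abs_int) auto
  then show ?thesis
  proof (rule summable_on_comparison_test)
    fix n :: int
    define x where "x = q * of_int n + b"
    have "\<bar>q\<bar> * \<bar>of_int n\<bar> - \<bar>b\<bar> \<le> \<bar>x\<bar>"
      unfolding x_def abs_mult [symmetric] by arith
    also have "\<dots> \<le> 1 + x\<^sup>2"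
      using zero_le_power2[of "\<bar>x\<bar> - 1"] zero_le_power2[of x] by (simp add: power2_diff)
    finally have "k * (\<bar>q\<bar> * \<bar>of_int n\<bar> - \<bar>b\<bar>) \<le> k * (1 + x\<^sup>2)"
      using assms by (intro mult_left_mono) auto
    then show "exp (- k * (q * of_int n + b)\<^sup>2)
        \<le> exp (k * (1 + \<bar>b\<bar>)) * exp (- (k * \<bar>q\<bar>) * \<bar>of_int n\<bar>)"
      unfolding x_def [symmetric] by (simp add: exp_add [symmetric] algebra_simps)
  qed auto
qed

section \<open>Gaussian sums in several variables\<close>

lemma summable_on_mult_Times:
  fixes f :: "'a \<Rightarrow> real" and g :: "'b \<Rightarrow> real"
  assumes "f summable_on A" "g summable_on B" "\<And>x. f x \<ge> 0" "\<And>x. g x \<ge> 0"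
  shows "(\<lambda>(x, y). f x * g y) summable_on A \<times> B"
proof (rule summable_on_SigmaI)
  show "((\<lambda>y. case (x, y) of (x, y) \<Rightarrow> f x * g y) has_sum f x * infsum g B) B" for x
    using assms(2) by (simp add: has_sum_cmult_right)
  show "(\<lambda>x. f x * infsum g B) summable_on A"
    using assms(1) by (rule summable_on_cmult_left)
  show "(case (x, y) of (x, y) \<Rightarrow> f x * g y) \<ge> 0" for x y
    using assms(3,4) by simp
qed

lemma int_vecs_Suc:
  "int_vecs (Suc m) = (\<lambda>(n, v). vCons (of_int n) v) ` (UNIV \<times> int_vecs m)"
proof (intro equalityI subsetI)
  fix w assume w: "w \<in> int_vecs (Suc m)"
  then obtain a v where av: "w = vCons a v" "v \<in> carrier_vec m"
    by (cases w) (auto simp: int_vecs_def zero_vec_Suc)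
  have ints: "vCons a v $ i \<in> \<int>" if "i < Suc m" for i
    using w that by (simp add: int_vecs_def av)
  obtain n where "a = of_int n" using ints[of 0] by (auto elim: Ints_cases)
  moreover have "v \<in> int_vecs m" using ints[of "Suc i" for i] av by (simp add: int_vecs_def)
  ultimately show "w \<in> (\<lambda>(n, v). vCons (of_int n) v) ` (UNIV \<times> int_vecs m)"
    using av by auto
next
  fix w :: "real vec" assume "w \<in> (\<lambda>(n, v). vCons (of_int n) v) ` (UNIV \<times> int_vecs m)"
  then show "w \<in> int_vecs (Suc m)"
    by (auto simp: int_vecs_def less_Suc_eq_0_disj)
qed

text \<open>The Gaussian factors over the coordinates, so one coordinate is split off at a time. The
  shifts \<open>b\<close> are kept arbitrary because the remaining coordinates use the shifts from
  index 1 on.\<close>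

lemma summable_on_gaussian_int_vecs:
  fixes k q :: real
  assumes "k > 0" "q \<noteq> 0"
  shows "(\<lambda>v. exp (- k * (\<Sum>i<m. (q * v $ i + b i)\<^sup>2))) summable_on int_vecs m"
proof (induction m arbitrary: b)
  case 0
  have "int_vecs 0 \<subseteq> {0\<^sub>v 0}" by (auto simp: int_vecs_def)
  then have "finite (int_vecs 0)" by (rule finite_subset) simp
  then show ?case by (rule summable_on_finite)
next
  case (Suc m)
  have "(\<lambda>(n, v). exp (- k * (q * of_int n + b 0)\<^sup>2)
      * exp (- k * (\<Sum>i<m. (q * v $ i + b (Suc i))\<^sup>2))) summable_on (UNIV :: int set) \<times> int_vecs m"
    using summable_on_gaussian_int[OF assms] Suc.IH[of "\<lambda>i. b (Suc i)"]
    by (intro summable_on_mult_Times) auto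
  also have "?this \<longleftrightarrow> (\<lambda>w. exp (- k * (\<Sum>i<Suc m. (q * w $ i + b i)\<^sup>2))) \<circ>
      (\<lambda>(n, v). vCons (of_int n) v) summable_on UNIV \<times> int_vecs m"
    by (intro summable_on_cong)
       (auto simp: sum.lessThan_Suc_shift exp_add [symmetric] algebra_simps simp del: sum.lessThan_Suc)
  also have "\<dots> \<longleftrightarrow> ?case"
    unfolding int_vecs_Suc by (rule summable_on_reindex [symmetric]) (auto simp: inj_on_def)
  finally show ?case .
qed

section \<open>Summation over residues\<close>

text \<open>\<open>V\<close> stands for the coset of the middle coordinate and \<open>H\<close> for
  the part of the summand common to all \<open>a\<close>. Both stay abstract, which separates the
  arithmetic modulo \<open>p\<close> from the theta series.\<close>

definition hecke_sum ::
  "'v set \<Rightarrow> int \<Rightarrow> int \<Rightarrow> int \<Rightarrow> (int \<times> 'v \<times> int \<Rightarrow> complex) \<Rightarrow> complex" where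
  "hecke_sum V p c d H = (\<Sum>a = 0..p - 1. \<Sum>\<^sub>\<infinity>(l1, l, l3) \<in> UNIV \<times> V \<times> UNIV.
     H (p * l1 - c * a, l, l3) * ee (- of_int (d * a * l3) / of_int p))"

section \<open>The additive character modulo \<open>p\<close>\<close>

lemma ee_add: "ee (x + y) = ee x * ee y"
  by (simp add: ee_def exp_add distrib_left)

lemma ee_of_int [simp]: "ee (of_int n) = 1"
proof -
  have "ee (of_int n) = cis (2 * pi * of_int n)"
    by (simp add: ee_def cis_conv_exp mult_ac)
  then show ?thesis by (simp add: cis_multiple_2pi)
qed

lemma ee_cong:
  assumes "[a = b] (mod p)" "p \<noteq> 0"
  shows "ee (of_int a / of_int p) = ee (of_int b / of_int p)"
proof -
  obtain k where k: "a = b + p * k"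
    using assms(1) by (metis cong_iff_lin cong_sym)
  have "of_int a / of_int p = (of_int b / of_int p + of_int k :: complex)"
    using assms(2) by (simp add: k field_simps)
  then show ?thesis by (simp add: ee_add)
qed

text \<open>Orthogonality of characters: if \<open>p\<close> does not divide \<open>j\<close>, the
  sum is geometric with ratio a \<open>p\<close>-th root of unity other than 1.\<close>

lemma sum_ee_eq:
  fixes p j :: int
  assumes "p > 0"
  shows "(\<Sum>a = 0..p - 1. ee (- of_int (j * a) / of_int p)) = (if p dvd j then of_int p else 0)"
proof (cases "p dvd j")
  case True
  have "ee (- of_int (j * a) / of_int p) = 1" for a
    using ee_cong[of "- (j * a)" 0 p] True assms ee_of_int[of 0]
    by (simp add: cong_0_iff)
  then show ?thesis using True assms by simp
next
  case False
  define w where "w = ee (- of_int j / of_int p)"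
  have w_pow: "ee (- of_int (j * int n) / of_int p) = w ^ n" for n
  proof (induction n)
    case 0
    show ?case using ee_of_int[of 0] by simp
  next
    case (Suc n)
    have "- of_int (j * int (Suc n)) / of_int p
        = - of_int j / of_int p + (- of_int (j * int n) / of_int p :: complex)"
      by (simp add: algebra_simps add_divide_distrib diff_divide_distrib)
    then show ?case by (simp only: ee_add Suc.IH power_Suc w_def)
  qed
  have "w \<noteq> 1"
  proof
    assume "w = 1"
    moreover have "w = cis (2 * pi * (- of_int j / of_int p))"
      by (simp add: w_def ee_def cis_conv_exp mult_ac)
    ultimately have "cos (2 * pi * (- of_int j / of_int p)) = 1"
      using cis.sel(1) one_complex.sel(1) by metis
    then obtain n :: int where "2 * pi * (- of_int j / of_int p) = of_int n * 2 * pi"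
      unfolding cos_one_2pi_int by blast
    then have "pi * real_of_int j = pi * of_int (- n * p)" using assms by (simp add: field_simps)
    then have "real_of_int j = of_int (- n * p)" by (simp only: mult_cancel_left) simp
    then have "j = - n * p" by (simp only: of_int_eq_iff)
    with False show False by simp
  qed
  have "(\<Sum>a = 0..p - 1. ee (- of_int (j * a) / of_int p))
      = (\<Sum>n<nat p. ee (- of_int (j * int n) / of_int p))"
  proof -
    have "{0..p - 1} = int ` {..<nat p}"
    proof -
      have "a \<in> int ` {..<nat p}" if "a \<in> {0..p - 1}" for a
        using that by (intro image_eqI[of _ _ "nat a"]) auto
      then show ?thesis using assms by auto
    qed
    then show ?thesis by (simp only: sum.reindex inj_on_of_nat o_def)
  qed
  also have "\<dots> = (\<Sum>n<nat p. w ^ n)" by (simp only: w_pow)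
  also have "\<dots> = (w ^ nat p - 1) / (w - 1)"
    using \<open>w \<noteq> 1\<close> by (rule geometric_sum)
  also have "w ^ nat p = ee (of_int (- j))"
    using w_pow[of "nat p"] assms by simp
  finally show ?thesis using False by (simp only: ee_of_int) simp
qed

text \<open>If \<open>p\<close> does not divide \<open>c\<close>, the sum over \<open>a\<close> and \<open>l\<^sub>1\<close> of the summand at \<open>p l\<^sub>1 - c a\<close>
  is one sum over all integers \<open>n\<^sub>1\<close>, because \<open>a\<close> is determined by \<open>n\<^sub>1\<close> modulo \<open>p\<close>.\<close>

lemma hecke_sum_coprime:
  assumes p: "p > 0" and c': "[c * c' = 1] (mod p)"
    and nrm: "(\<lambda>x. norm (H x)) summable_on UNIV \<times> V \<times> UNIV"
  shows "hecke_sum V p c d H = (\<Sum>\<^sub>\<infinity>(n1, l, n3) \<in> UNIV \<times> V \<times> UNIV.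
     H (n1, l, n3) * ee (of_int (d * c' * n1 * n3) / of_int p))"
proof -
  define G where "G = (\<lambda>(n1, l, n3). H (n1, l, n3) * ee (of_int (d * c' * n1 * n3) / of_int p))"
  define B where "B a = {n1. p dvd n1 + c * a} \<times> V \<times> (UNIV :: int set)" for a
  have "(\<Sum>\<^sub>\<infinity>(l1, l, l3) \<in> UNIV \<times> V \<times> UNIV.
      H (p * l1 - c * a, l, l3) * ee (- of_int (d * a * l3) / of_int p)) = infsum G (B a)" for a
  proof (rule infsum_reindex_bij_witness[where j = "\<lambda>(l1, l, l3). (p * l1 - c * a, l, l3)"
        and i = "\<lambda>(n1, l, n3). ((n1 + c * a) div p, l, n3)"], goal_cases)
    case (5 x)
    obtain l1 l l3 where x: "x = (l1, l, l3)" by (cases x)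
    \<comment> \<open>Modulo \<open>p\<close> the first factor reduces to \<open>- c * a\<close>,
      and \<open>c'\<close> cancels \<open>c\<close>; so the phase written in \<open>n1\<close>
      reproduces the one written in \<open>a\<close>.\<close>
    have "[d * c' * (p * l1 - c * a) * l3 = - (d * a * l3)] (mod p)"
    proof -
      have "p dvd c * c' - 1" using c' by (simp add: cong_iff_dvd_diff)
      then have "p dvd d * c' * p * l1 * l3 - d * a * l3 * (c * c' - 1)" by auto
      also have "\<dots> = d * c' * (p * l1 - c * a) * l3 - (- (d * a * l3))"
        by (simp add: algebra_simps)
      finally show ?thesis by (simp only: cong_iff_dvd_diff)
    qed
    from ee_cong[OF this] p show ?case by (simp add: x G_def)
  qed (use p in \<open>auto simp: B_def\<close>)
  then have "hecke_sum V p c d H = (\<Sum>a = 0..p - 1. infsum G (B a))"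
    by (simp add: hecke_sum_def)
  also have "\<dots> = infsum G (\<Union>a\<in>{0..p - 1}. B a)"
  proof (rule sum_infsum)
    have "(\<lambda>x. norm (G x)) summable_on UNIV \<times> V \<times> UNIV"
      using nrm by (simp add: G_def case_prod_unfold norm_mult ee_def)
    then have "G summable_on UNIV \<times> V \<times> UNIV" by (rule abs_summable_summable)
    then show "G summable_on B a" for a
      by (rule summable_on_subset_banach) (auto simp: B_def)
  next
    fix a a' assume a: "a \<in> {0..p - 1}" "a' \<in> {0..p - 1}" "a \<noteq> a'"
    \<comment> \<open>Multiplying by \<open>c'\<close> cancels \<open>c\<close>, and distinct
      elements of \<open>{0..p - 1}\<close> are incongruent.\<close>
    have False if "p dvd n + c * a" "p dvd n + c * a'" for n
    proof -
      have "p dvd c * a - c * a'" using dvd_diff[OF that] by simp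
      then have "[c * a = c * a'] (mod p)" by (simp add: cong_iff_dvd_diff)
      then have "[c * c' * a = c * c' * a'] (mod p)"
        by (metis cong_scalar_left mult.assoc mult.commute)
      then have "[a = a'] (mod p)"
        using cong_scalar_right[OF c', of a] cong_scalar_right[OF c', of a']
        by (metis cong_sym cong_trans mult_1)
      with a show False using p by (simp add: cong_def)
    qed
    then show "B a \<inter> B a' = {}" by (auto simp: B_def)
  qed simp
  also have "(\<Union>a\<in>{0..p - 1}. B a) = UNIV \<times> V \<times> UNIV"
  proof -
    have "\<exists>a\<in>{0..p - 1}. p dvd n + c * a" for n
    proof (rule bexI)
      \<comment> \<open>The witness solves \<open>n + c * a = 0\<close> modulo \<open>p\<close> for
        \<open>a\<close>.\<close>
      show "(- c' * n) mod p \<in> {0..p - 1}" using p by simp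
      have "[n + c * ((- c' * n) mod p) = n + c * (- c' * n)] (mod p)"
        by (intro cong_add cong_mult) auto
      also have "n + c * (- c' * n) = - n * (c * c' - 1)" by (simp add: algebra_simps)
      also have "[\<dots> = 0] (mod p)" using c' by (simp add: cong_iff_dvd_diff)
      finally show "p dvd n + c * ((- c' * n) mod p)" by (simp add: cong_0_iff)
    qed
    then show ?thesis by (auto simp: B_def)
  qed
  finally show ?thesis by (simp add: G_def)
qed

lemma infsum_sum:
  fixes f :: "'a \<Rightarrow> 'b \<Rightarrow> 'c :: {topological_comm_monoid_add, t2_space}"
  assumes "\<And>i. i \<in> I \<Longrightarrow> f i summable_on A"
  shows "(\<Sum>\<^sub>\<infinity>x\<in>A. \<Sum>i\<in>I. f i x) = (\<Sum>i\<in>I. infsum (f i) A)"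
proof -
  have "((\<lambda>x. \<Sum>i\<in>I. f i x) has_sum (\<Sum>i\<in>I. infsum (f i) A)) A"
    using assms by (induction I rule: infinite_finite_induct) (auto intro!: has_sum_add)
  then show ?thesis by (rule infsumI)
qed

text \<open>With \<open>c = p * e\<close> the first argument of \<open>H\<close> is
  \<open>p * (l1 - e * a)\<close>, so a translation of \<open>l1\<close> removes \<open>a\<close>
  from \<open>H\<close>. Only the character still depends on \<open>a\<close>, and summing it leaves
  the indices with \<open>p dvd d * l3\<close>.\<close>

lemma hecke_sum_dvd:
  assumes p: "p > 0" and c: "p dvd c" 
    and nrm: "(\<lambda>x. norm (H x)) summable_on UNIV \<times> V \<times> UNIV"
  shows "hecke_sum V p c d H = of_int p * (\<Sum>\<^sub>\<infinity>(l1, l, l3) \<in> UNIV \<times> V \<times> {l3. p dvd d * l3}.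
     H (p * l1, l, l3))"
proof -
  obtain e where e: "c = p * e" using c by auto
  define G where "G = (\<lambda>(l1, l, l3). H (p * l1, l, l3))"
  let ?D = "UNIV \<times> V \<times> (UNIV :: int set)"
  let ?E = "\<lambda>a (l1 :: int, l :: 'a, l3). ee (- of_int (d * l3 * a) / of_int p)"
  have G: "(\<lambda>x. norm (G x)) summable_on ?D"
  proof -
    have "(\<lambda>x. norm (H x)) summable_on (\<lambda>(l1, l, l3). (p * l1, l, l3)) ` ?D"
      using nrm by (rule summable_on_subset_banach) auto
    also have "?this \<longleftrightarrow> ?thesis"
      using p by (subst summable_on_reindex) (auto simp: inj_on_def o_def G_def case_prod_unfold)
    finally show ?thesis .
  qed
  have "(\<Sum>\<^sub>\<infinity>(l1, l, l3) \<in> ?D. H (p * l1 - c * a, l, l3) * ee (- of_int (d * a * l3) / of_int p))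
      = (\<Sum>\<^sub>\<infinity>x \<in> ?D. G x * ?E a x)" for a
    by (rule infsum_reindex_bij_witness[where j = "\<lambda>(l1, l, l3). (l1 - e * a, l, l3)"
        and i = "\<lambda>(l1, l, l3). (l1 + e * a, l, l3)"]) (auto simp: G_def e algebra_simps)
  then have "hecke_sum V p c d H = (\<Sum>a = 0..p - 1. \<Sum>\<^sub>\<infinity>x \<in> ?D. G x * ?E a x)"
    by (simp add: hecke_sum_def)
  also have "\<dots> = (\<Sum>\<^sub>\<infinity>x \<in> ?D. \<Sum>a = 0..p - 1. G x * ?E a x)"
  proof (rule infsum_sum [symmetric])
    fix a
    have "(\<lambda>x. norm (G x * ?E a x)) summable_on ?D"
      using G by (simp add: case_prod_unfold norm_mult ee_def)
    then show "(\<lambda>x. G x * ?E a x) summable_on ?D" by (rule abs_summable_summable)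
  qed
  also have "\<dots> = (\<Sum>\<^sub>\<infinity>x \<in> ?D. G x * (if p dvd d * snd (snd x) then of_int p else 0))"
    by (simp only: sum_distrib_left [symmetric] case_prod_unfold sum_ee_eq[OF p])
  also have "\<dots> = (\<Sum>\<^sub>\<infinity>x \<in> UNIV \<times> V \<times> {l3. p dvd d * l3}. of_int p * G x)"
    by (rule infsum_cong_neutral) auto
  finally show ?thesis by (simp add: infsum_cmult_right' G_def case_prod_unfold)
qed

text \<open>Polymorphic, so that one exchange acts both on real triples and on the integer indices
  of \<open>hecke_sum\<close>.\<close>

definition swap3 :: "'a \<times> 'b \<times> 'c \<Rightarrow> 'c \<times> 'b \<times> 'a" where
  "swap3 = (\<lambda>(x1, x2, x3). (x3, x2, x1))"

lemma summable_on_swap3: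
  assumes "f summable_on A \<times> B \<times> C"
  shows "(\<lambda>x. f (swap3 x)) summable_on C \<times> B \<times> A"
proof -
  have "(\<lambda>x. f (swap3 x)) summable_on C \<times> B \<times> A \<longleftrightarrow> f summable_on A \<times> B \<times> C"
    by (rule summable_on_reindex_bij_witness[where i = swap3 and j = swap3]) (auto simp: swap3_def)
  with assms show ?thesis by simp
qed

lemma hecke_sum_swap:
  assumes p: "prime p" and cd: "\<not> p dvd c \<or> \<not> p dvd d"
    and nrm: "(\<lambda>x. norm (H x)) summable_on UNIV \<times> V \<times> UNIV"
  shows "hecke_sum V p c d (H \<circ> swap3) = hecke_sum V p c d H"
proof -
  have p0: "p > 0" using p by (rule prime_gt_0_int)
  have nrm': "(\<lambda>x. norm ((H \<circ> swap3) x)) summable_on UNIV \<times> V \<times> UNIV"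
    unfolding o_def by (rule summable_on_swap3[OF nrm])
  show ?thesis
  proof (cases "p dvd c")
    case True
    with p cd have dvd: "p dvd d * l \<longleftrightarrow> p dvd l" for l by (auto simp: prime_dvd_mult_iff)
    \<comment> \<open>An involution on triples whose last entry is divisible by \<open>p\<close>: it
      exchanges the outer coordinates and moves the factor \<open>p\<close> from one to the
      other.\<close>
    let ?f = "\<lambda>(l1, l, l3). (l3 div p, l, p * l1)"
    have "(\<Sum>\<^sub>\<infinity>(l1, l, l3) \<in> UNIV \<times> V \<times> {l3. p dvd l3}. (H \<circ> swap3) (p * l1, l, l3))
        = (\<Sum>\<^sub>\<infinity>(l1, l, l3) \<in> UNIV \<times> V \<times> {l3. p dvd l3}. H (p * l1, l, l3))"
      using p0 by (intro infsum_reindex_bij_witness[where j = ?f and i = ?f]) (auto simp: swap3_def)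
    then show ?thesis
      unfolding hecke_sum_dvd[OF p0 True nrm] hecke_sum_dvd[OF p0 True nrm'] dvd by (rule arg_cong)
  next
    case False
    then have "coprime c p" using p by (metis coprime_commute prime_imp_coprime)
    then obtain c' where "[c * c' = 1] (mod p)" using cong_solve_coprime_int by blast
    then have "hecke_sum V p c d H' = (\<Sum>\<^sub>\<infinity>(n1, l, n3) \<in> UNIV \<times> V \<times> UNIV.
        H' (n1, l, n3) * ee (of_int (d * c' * n1 * n3) / of_int p))"
      if "(\<lambda>x. norm (H' x)) summable_on UNIV \<times> V \<times> UNIV" for H'
      using hecke_sum_coprime[OF p0 _ that] by blast
    note eq = this[OF nrm] this[OF nrm']
    \<comment> \<open>The phase involves only the product \<open>n1 * n3\<close>, which the exchange
      preserves.\<close>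
    have "(\<Sum>\<^sub>\<infinity>(n1, l, n3) \<in> UNIV \<times> V \<times> UNIV.
        (H \<circ> swap3) (n1, l, n3) * ee (of_int (d * c' * n1 * n3) / of_int p))
      = (\<Sum>\<^sub>\<infinity>(n1, l, n3) \<in> UNIV \<times> V \<times> UNIV.
        H (n1, l, n3) * ee (of_int (d * c' * n1 * n3) / of_int p))"
    proof (rule infsum_reindex_bij_witness[where j = swap3 and i = swap3], goal_cases)
      case (5 x)
      obtain n1 l n3 where "x = (n1, l, n3)" by (cases x)
      moreover have "d * c' * n3 * n1 = d * c' * n1 * n3" by simp
      ultimately show ?case by (simp only: swap3_def prod.case o_def)
    qed (auto simp: swap3_def)
    then show ?thesis unfolding eq .
  qed
qed

section \<open>Theta series\<close>

definition theta_term :: "real mat \<Rightarrow> complex \<Rightarrow> triple \<Rightarrow> triple \<Rightarrow> triple \<Rightarrow> triple \<Rightarrow> complex" where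
  "theta_term S \<tau> Y r t v =
     ee (\<i> * of_real (Im \<tau>) * of_real ((Q1 S (v + t) Y)\<^sup>2 / Q1 S Y Y)
         + cnj \<tau> / 2 * of_real (Q1 S (v + t) (v + t))
         - of_real (Q1 S (v + tscale (1/2) t) r))"

text \<open>The outer indices become elements of type \<open>int\<close>, so that congruences modulo
  \<open>p\<close> can be applied to them.\<close>

lemma theta_eq_infsum:
  "theta m S \<alpha>0 \<tau> Y r t = (\<Sum>\<^sub>\<infinity>(l1, l, l3) \<in> UNIV \<times> (+) \<alpha>0 ` int_vecs m \<times> UNIV.
     theta_term S \<tau> Y r t (of_int l1, l, of_int l3))"
proof -
  let ?g = "\<lambda>(l1 :: int, l :: real vec, l3 :: int). (real_of_int l1, l, real_of_int l3)"
  have "(\<lambda>l. (0, \<alpha>0, 0) + l) ` L1 m = ?g ` (UNIV \<times> (+) \<alpha>0 ` int_vecs m \<times> UNIV)"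
    by (force simp: L1_def image_iff elim!: Ints_cases)
  then show ?thesis
    unfolding theta_def theta_term_def [symmetric]
    by (simp only:) (subst infsum_reindex; auto simp: inj_on_def o_def case_prod_unfold)
qed

section \<open>Invariance of the theta series under exchange of the outer coordinates\<close>

lemma swap3_swap3 [simp]: "swap3 (swap3 x) = x"
  by (simp add: swap3_def case_prod_unfold)

lemma swap3_add: "swap3 (u + v) = swap3 u + swap3 v"
  by (cases u; cases v) (simp add: swap3_def)

lemma swap3_tscale: "swap3 (tscale k u) = tscale k (swap3 u)"
  by (cases u) (simp add: swap3_def tscale_def)

lemma swap3_triples [simp]: "swap3 u \<in> triples m \<longleftrightarrow> u \<in> triples m"
  by (cases u) (simp add: swap3_def)

lemma Q1_swap3: "Q1 S (swap3 u) (swap3 v) = Q1 S u v"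
  by (cases u; cases v) (simp add: Q1_def swap3_def)

lemma theta_swap3: "theta m S \<alpha>0 \<tau> (swap3 Y) (swap3 r) (swap3 t) = theta m S \<alpha>0 \<tau> Y r t"
proof -
  have "theta_term S \<tau> (swap3 Y) (swap3 r) (swap3 t) (swap3 v) = theta_term S \<tau> Y r t v" for v
    unfolding theta_term_def swap3_add [symmetric] swap3_tscale [symmetric] Q1_swap3 ..
  from this[of "(_, _, _)"] show ?thesis
    unfolding theta_eq_infsum
    by (intro infsum_reindex_bij_witness[where i = swap3 and j = swap3]) (auto simp: swap3_def)
qed

lemma down_minus_swap3: "down_minus p a (swap3 X) = swap3 (up_minus p a X)"
  by (cases X) (simp add: swap3_def down_minus_def up_minus_def)

lemma up_plus_swap3: "up_plus p (swap3 X) = swap3 (down_plus p X)"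
  by (cases X) (simp add: swap3_def down_plus_def up_plus_def)

lemma I_down_minus_swap3:
  "I_down_minus m S \<alpha>0 p \<tau> (swap3 X) (swap3 Y) c d = I_up_minus m S \<alpha>0 p \<tau> X Y c d"
  unfolding I_down_minus_def I_up_minus_def down_minus_swap3 swap3_tscale [symmetric] theta_swap3 ..

lemma I_up_plus_swap3:
  "I_up_plus m S \<alpha>0 p \<tau> (swap3 X) (swap3 Y) c d = I_down_plus m S \<alpha>0 p \<tau> X Y c d"
  unfolding I_up_plus_def I_down_plus_def up_plus_swap3 swap3_tscale [symmetric] theta_swap3 ..

text \<open>The operator \<open>up_minus p 0\<close> is a similitude of ratio \<open>1 / p\<close>. In the coordinates
  \<open>n\<^sub>1 = p l\<^sub>1 - c a\<close> the theta series occurring in \<open>I_up_minus\<close> therefore have the common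
  summand below, up to a root of unity depending on \<open>a\<close>.\<close>

definition hecke_kernel ::
  "real mat \<Rightarrow> complex \<Rightarrow> nat \<Rightarrow> triple \<Rightarrow> triple \<Rightarrow> int \<Rightarrow> int \<Rightarrow> int \<times> real vec \<times> int \<Rightarrow> complex" where
  "hecke_kernel S \<tau> p X Y c d = (\<lambda>(n1, l, n3).
     let v = (of_int n1, sqrt p \<cdot>\<^sub>v l, of_int n3); w = v + tscale (- of_int c) X in
     ee ((\<i> * of_real (Im \<tau>) * of_real ((Q1 S w Y)\<^sup>2 / Q1 S Y Y) + cnj \<tau> / 2 * of_real (Q1 S w w)
         - of_real (Q1 S (v + tscale (- of_int c / 2) X) (tscale (of_int d) X))) / of_nat p))"

lemma hecke_kernel_swap3:
  "hecke_kernel S \<tau> p (swap3 X) (swap3 Y) c d = hecke_kernel S \<tau> p X Y c d \<circ> swap3"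
proof
  fix n :: "int \<times> real vec \<times> int"
  obtain n1 l n3 where n: "n = (n1, l, n3)" by (cases n)
  have "(of_int n1, sqrt p \<cdot>\<^sub>v l, of_int n3) = swap3 (real_of_int n3, sqrt p \<cdot>\<^sub>v l, real_of_int n1)"
    "swap3 (n1, l, n3) = (n3, l, n1)"
    by (simp_all add: swap3_def)
  then show "hecke_kernel S \<tau> p (swap3 X) (swap3 Y) c d n = (hecke_kernel S \<tau> p X Y c d \<circ> swap3) n"
    by (simp add: hecke_kernel_def Let_def n swap3_add [symmetric]
        swap3_tscale [symmetric] Q1_swap3)
qed

section \<open>Theta summands under the similitude \<open>up_minus p 0\<close>\<close>

lemma Q1_up_minus:
  assumes "S \<in> carrier_mat m m" "u \<in> triples m" "v \<in> triples m" "p > 0"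
  shows "Q1 S (up_minus p 0 u) (up_minus p 0 v) = Q1 S u v / p"
proof -
  obtain u1 u2 u3 v1 v2 v3 where uv: "u = (u1, u2, u3)" "v = (v1, v2, v3)"
    by (cases u, cases v)
  have "sform S (k \<cdot>\<^sub>v u2) (k \<cdot>\<^sub>v v2) = k\<^sup>2 * sform S u2 v2" for k
    using assms unfolding uv sform_def by (simp add: mult_mat_vec power2_eq_square)
  then show ?thesis
    using assms(4) by (simp add: uv Q1_def up_minus_def power_divide diff_divide_distrib add_divide_distrib)
qed

lemma down_plus_eq: "p > 0 \<Longrightarrow> down_plus p X = tscale p (up_minus p 0 X)"
  by (cases X) (simp add: down_plus_def up_minus_def tscale_def smult_smult_assoc real_div_sqrt)

lemma tscale_tscale: "tscale a (tscale b X) = tscale (a * b) X"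
  by (cases X) (simp add: tscale_def smult_smult_assoc mult.assoc)

text \<open>In the coordinates \<open>n\<close> the vector \<open>v + t\<close> is the image of
  \<open>w\<close> under \<open>up_minus p 0\<close>. Hence the quadratic terms only acquire the
  factor \<open>1 / p\<close>, and the root of unity comes from the linear phase.\<close>

lemma theta_term_up_minus:
  assumes S: "S \<in> carrier_mat m m" and p: "p > 0" and X: "X \<in> triples m" and Y: "Y \<in> triples m"
    and l: "l \<in> carrier_vec m"
  shows "theta_term S \<tau> (up_minus p 0 Y) (tscale (of_int d) (up_minus p a X))
      (tscale (- of_int c) (up_minus p a X)) (of_int l1, l, of_int l3)
    = hecke_kernel S \<tau> p X Y c d (int p * l1 - c * a, l, l3) * ee (- of_int (d * a * l3) / of_int (int p))"
proof -
  obtain x X0 x' where X': "X = (x, X0, x')" and X0: "X0 \<in> carrier_vec m" using X by (cases X) auto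
  define v where "v = (real_of_int l1, l, real_of_int l3)"
  define n where "n = (real_of_int (int p * l1 - c * a), sqrt p \<cdot>\<^sub>v l, real_of_int l3)"
  define t where "t = tscale (- of_int c) (up_minus p a X)"
  define w where "w = n + tscale (- of_int c) X"
  define u where "u = n + tscale (- of_int c / 2) X"
  define r where "r = tscale (of_int d) X"
  \<comment> \<open>\<open>n\<close> absorbs the whole shift \<open>c * a\<close>, but half of
    \<open>t\<close> accounts for only half of it; \<open>k\<close> restores the difference.
    Likewise \<open>h\<close> is the contribution of \<open>a\<close> to the vector
    \<open>r\<close>.\<close>
  define k :: triple where "k = (of_int (c * a) / 2, 0\<^sub>v m, 0)"
  define h :: triple where "h = (of_int (d * a), 0\<^sub>v m, 0)"
  have mid: "l + e \<cdot>\<^sub>v ((1 / sqrt p) \<cdot>\<^sub>v X0) = (1 / sqrt p) \<cdot>\<^sub>v (sqrt p \<cdot>\<^sub>v l + e \<cdot>\<^sub>v X0)" for e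
    using p X0 l by (intro eq_vecI) (auto simp: field_simps)
  have nt: "n \<in> triples m" "r \<in> triples m" "u \<in> triples m" "w \<in> triples m" "k \<in> triples m" "h \<in> triples m"
    using X l by (auto simp: n_def r_def u_def w_def k_def h_def)
  have vt: "v + t = up_minus p 0 w"
    using p mid by (simp add: v_def t_def w_def n_def X' tscale_def up_minus_def field_simps)
  have vt2: "v + tscale (1/2) t = up_minus p 0 (u + k)"
    using p mid[of "- of_int c / 2"] X0 l
    by (simp add: v_def t_def u_def k_def n_def X' tscale_def up_minus_def field_simps smult_smult_assoc)
  have r: "tscale (of_int d) (up_minus p a X) = up_minus p 0 (r + h)"
    using X0 by (simp add: r_def h_def X' tscale_def up_minus_def field_simps smult_smult_assoc)
  \<comment> \<open>The two cross terms containing \<open>x'\<close> cancel, and \<open>k\<close>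
    and \<open>h\<close> are orthogonal.\<close>
  have "Q1 S (u + k) (r + h) = Q1 S u r + of_int (d * a * l3)"
    using X0 l S by (simp add: u_def k_def r_def h_def n_def X' Q1_def tscale_def algebra_simps)
  then have "Q1 S (v + tscale (1/2) t) (tscale (of_int d) (up_minus p a X))
      = Q1 S u r / p + of_int (d * a * l3) / p"
    unfolding vt2 r using nt S p by (subst Q1_up_minus[of _ m]) (simp_all add: add_divide_distrib)
  moreover have "(Q1 S (v + t) (up_minus p 0 Y))\<^sup>2 / Q1 S (up_minus p 0 Y) (up_minus p 0 Y)
      = ((Q1 S w Y)\<^sup>2 / Q1 S Y Y) / p"
    unfolding vt using nt S p Y by (simp add: Q1_up_minus[of _ m] power2_eq_square)
  moreover have "Q1 S (v + t) (v + t) = Q1 S w w / p"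
    unfolding vt using nt S p by (simp add: Q1_up_minus[of _ m])
  ultimately show ?thesis
    unfolding theta_term_def v_def [symmetric] t_def [symmetric] hecke_kernel_def prod.case Let_def
      n_def [symmetric] w_def [symmetric] u_def [symmetric] r_def [symmetric] ee_add [symmetric]
    by (intro arg_cong[where f = ee]) (simp add: add_divide_distrib diff_divide_distrib)
qed

lemma I_up_minus_eq_hecke_sum:
  assumes "S \<in> carrier_mat m m" "p > 0" "X \<in> triples m" "Y \<in> triples m" "\<alpha>0 \<in> carrier_vec m"
  shows "I_up_minus m S \<alpha>0 p \<tau> X Y c d
    = hecke_sum ((+) \<alpha>0 ` int_vecs m) p c d (hecke_kernel S \<tau> p X Y c d)"
  unfolding I_up_minus_def hecke_sum_def theta_eq_infsum
  using assms
  by (intro sum.cong infsum_cong refl)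
     (auto simp: int_vecs_def theta_term_up_minus[of S m, simplified])

text \<open>By \<open>down_plus_eq\<close>, \<open>down_plus p\<close> is \<open>p\<close> times
  \<open>up_minus p 0\<close>. On \<open>X\<close> the factor \<open>p\<close> turns
  \<open>c div int p\<close> and \<open>d div int p\<close> back into \<open>c\<close> and
  \<open>d\<close>.\<close>

lemma I_down_plus_eq_infsum:
  assumes S: "S \<in> carrier_mat m m" "transpose_mat S = S" and p: "p > 0"
    and X: "X \<in> triples m" and Y: "Y \<in> triples m" and \<alpha>0: "\<alpha>0 \<in> carrier_vec m"
    and cd: "int p dvd c" "int p dvd d"
  shows "I_down_plus m S \<alpha>0 p \<tau> X Y (c div int p) (d div int p)
    = (\<Sum>\<^sub>\<infinity>(l1, l, l3) \<in> UNIV \<times> (+) \<alpha>0 ` int_vecs m \<times> UNIV.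
         hecke_kernel S \<tau> p X Y c d (int p * l1, l, l3))"
proof -
  have scale: "tscale (of_int (e div int p)) (down_plus p X) = tscale (of_int e) (up_minus p 0 X)"
    "tscale (- of_int (e div int p)) (down_plus p X) = tscale (- of_int e) (up_minus p 0 X)"
    if "int p dvd e" for e
  proof -
    have "of_int (e div int p) * real p = of_int e"
      using that by (metis dvd_div_mult_self of_int_mult of_int_of_nat_eq)
    then show "tscale (of_int (e div int p)) (down_plus p X) = tscale (of_int e) (up_minus p 0 X)"
      "tscale (- of_int (e div int p)) (down_plus p X) = tscale (- of_int e) (up_minus p 0 X)"
      using p by (simp_all add: down_plus_eq tscale_tscale)
  qed
  have up: "up_minus p 0 Z \<in> triples m" if "Z \<in> triples m" for Z
    using that by (cases Z) (simp add: up_minus_def)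
  \<comment> \<open>The quotient is homogeneous of degree 0 in its \<open>Y\<close> argument, so
    scaling by \<open>p\<close> leaves it unchanged.\<close>
  have inv: "(Q1 S v (down_plus p Y))\<^sup>2 / Q1 S (down_plus p Y) (down_plus p Y)
      = (Q1 S v (up_minus p 0 Y))\<^sup>2 / Q1 S (up_minus p 0 Y) (up_minus p 0 Y)"
    if "v \<in> triples m" for v
    using S p up[OF Y] that
    by (simp add: down_plus_eq Q1_tscale_left[of _ m] Q1_tscale_right[of _ m] power2_eq_square)
  have "theta_term S \<tau> (down_plus p Y) (tscale (of_int (d div int p)) (down_plus p X))
      (tscale (- of_int (c div int p)) (down_plus p X)) (of_int l1, l, of_int l3)
    = hecke_kernel S \<tau> p X Y c d (int p * l1, l, l3)" if "l \<in> carrier_vec m" for l1 l l3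
  proof -
    have "(real_of_int l1, l, real_of_int l3) + tscale (- of_int c) (up_minus p 0 X) \<in> triples m"
      using that up[OF X] by simp
    then have "theta_term S \<tau> (down_plus p Y) (tscale (of_int (d div int p)) (down_plus p X))
        (tscale (- of_int (c div int p)) (down_plus p X)) (of_int l1, l, of_int l3)
      = theta_term S \<tau> (up_minus p 0 Y) (tscale (of_int d) (up_minus p 0 X))
        (tscale (- of_int c) (up_minus p 0 X)) (of_int l1, l, of_int l3)"
      unfolding scale(1)[OF cd(2)] scale(2)[OF cd(1)] theta_term_def by (simp only: inv)
    \<comment> \<open>The case \<open>a = 0\<close>, in which the root of unity is 1.\<close>
    also have "\<dots> = hecke_kernel S \<tau> p X Y c d (int p * l1, l, l3)"
      using theta_term_up_minus[OF S(1) p X Y that, of \<tau> d 0 c l1 l3] ee_of_int[of 0] by simp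
    finally show ?thesis .
  qed
  then show ?thesis
    unfolding I_down_plus_def theta_eq_infsum
    using \<alpha>0 by (intro infsum_cong) (auto simp: int_vecs_def)
qed

section \<open>Absolute convergence\<close>

lemma norm_hecke_kernel:
  "norm (hecke_kernel S \<tau> p X Y c d (n1, l, n3)) = exp (- (pi * Im \<tau> / p)
     * majorant S Y ((of_int n1, sqrt p \<cdot>\<^sub>v l, of_int n3) + tscale (- of_int c) X))"
proof -
  \<comment> \<open>Only the imaginary part of the argument matters, so the real phase drops out;
    with \<open>cnj \<tau>\<close> in place of \<open>z\<close>, the \<open>Q1\<close> term enters
    with a minus sign, as in \<open>majorant\<close>.\<close>
  have norm_ee: "norm (ee ((\<i> * of_real b * of_real A + z / 2 * of_real B - of_real C) / of_nat p))
      = exp (- (2 * pi * (b * A + Im z / 2 * B) / p))" for b A z B C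
    by (simp add: ee_def norm_exp_eq_Re)
  show ?thesis
    unfolding hecke_kernel_def prod.case Let_def norm_ee majorant_def
    by (simp add: algebra_simps diff_divide_distrib)
qed

text \<open>The coordinate bound for the majorant dominates the kernel by a product of Gaussians,
  one in each of the three components.\<close>

lemma abs_summable_hecke_kernel:
  assumes S: "pos_def_even_integral m S" and p: "p > 0" and \<tau>: "Im \<tau> > 0"
    and X: "X \<in> triples m" and Y: "Y \<in> Ycone m S" and \<alpha>0: "\<alpha>0 \<in> S_inv_int_vecs m S"
  shows "(\<lambda>x. norm (hecke_kernel S \<tau> p X Y c d x)) summable_on UNIV \<times> (+) \<alpha>0 ` int_vecs m \<times> UNIV"
proof -
  \<comment> \<open>The inverse of \<open>S\<close> is taken from the membership of
    \<open>\<alpha>0\<close> in \<open>S_inv_int_vecs m S\<close>.\<close>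
  obtain T where T: "T \<in> carrier_mat m m" "inverts_mat S T" and \<alpha>0m: "\<alpha>0 \<in> carrier_vec m"
    using \<alpha>0 by (force simp: S_inv_int_vecs_def int_vecs_def)
  obtain x X0 x' where X': "X = (x, X0, x')" and X0: "X0 \<in> carrier_vec m" using X by (cases X) auto
  obtain C where C: "C > 0" and bound: "\<And>a u b. u \<in> carrier_vec m \<Longrightarrow>
      a\<^sup>2 + (\<Sum>i<m. (u $ i)\<^sup>2) + b\<^sup>2 \<le> C * majorant S Y (a, u, b)"
    using triple_norm_le_majorant[OF S Y T] by blast
  \<comment> \<open>Chosen so that \<open>k * C\<close> is the decay rate in
    \<open>norm_hecke_kernel\<close>.\<close>
  define k where "k = pi * Im \<tau> / p / C"
  have k: "k > 0" using C p \<tau> by (simp add: k_def)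
  define b where "b i = sqrt p * \<alpha>0 $ i - of_int c * X0 $ i" for i
  let ?g = "\<lambda>(n1 :: int, v :: real vec, n3 :: int). (n1, \<alpha>0 + v, n3)"
  have "(\<lambda>(n1, z). exp (- k * (1 * of_int n1 + (- of_int c * x))\<^sup>2) * (case z of (v, n3) \<Rightarrow>
      exp (- k * (\<Sum>i<m. (sqrt p * v $ i + b i)\<^sup>2)) * exp (- k * (1 * of_int n3 + (- of_int c * x'))\<^sup>2)))
      summable_on (UNIV :: int set) \<times> (int_vecs m \<times> (UNIV :: int set))"
    using k p
    by (intro summable_on_mult_Times summable_on_gaussian_int summable_on_gaussian_int_vecs) auto
  then have "((\<lambda>n. norm (hecke_kernel S \<tau> p X Y c d n)) \<circ> ?g) summable_on UNIV \<times> int_vecs m \<times> UNIV"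
  proof (rule summable_on_comparison_test, goal_cases)
    case (1 n)
    obtain n1 v n3 where n: "n = (n1, v, n3)" by (cases n)
    have v: "v \<in> carrier_vec m" using 1 by (simp add: n int_vecs_def)
    define A where "A = of_int n1 - of_int c * x"
    define B where "B = of_int n3 - of_int c * x'"
    define u where "u = sqrt p \<cdot>\<^sub>v (\<alpha>0 + v) + (- of_int c) \<cdot>\<^sub>v X0"
    have u: "u \<in> carrier_vec m" using v \<alpha>0m X0 by (simp add: u_def)
    have "(\<Sum>i<m. (u $ i)\<^sup>2) = (\<Sum>i<m. (sqrt p * v $ i + b i)\<^sup>2)"
      using v \<alpha>0m X0 by (intro sum.cong) (auto simp: u_def b_def algebra_simps)
    moreover have "k * (A\<^sup>2 + (\<Sum>i<m. (u $ i)\<^sup>2) + B\<^sup>2) \<le> k * (C * majorant S Y (A, u, B))"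
      using bound[OF u] k by (intro mult_left_mono) auto
    moreover have "k * (C * majorant S Y (A, u, B)) = (pi * Im \<tau> / p) * majorant S Y (A, u, B)"
      using C by (simp add: k_def)
    ultimately show ?case
      unfolding n o_def prod.case norm_hecke_kernel
      by (simp add: exp_add [symmetric] X' tscale_def u_def [symmetric] A_def [symmetric] B_def [symmetric] distrib_left)
  qed auto
  moreover have "inj_on ?g (UNIV \<times> int_vecs m \<times> UNIV)"
  proof -
    have "v = v'" if "v \<in> int_vecs m" "v' \<in> int_vecs m" "\<alpha>0 + v = \<alpha>0 + v'" for v v'
    proof (rule eq_vecI)
      fix i assume "i < dim_vec v'"
      then show "v $ i = v' $ i"
        using that(1,2) arg_cong[OF that(3), of "\<lambda>u. u $ i"] by (auto simp: int_vecs_def)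
    qed (use that in \<open>auto simp: int_vecs_def\<close>)
    then show ?thesis by (auto simp: inj_on_def)
  qed
  ultimately have "(\<lambda>n. norm (hecke_kernel S \<tau> p X Y c d n)) summable_on ?g ` (UNIV \<times> int_vecs m \<times> UNIV)"
    by (subst summable_on_reindex)
  moreover have "?g ` (UNIV \<times> int_vecs m \<times> UNIV) = UNIV \<times> (+) \<alpha>0 ` int_vecs m \<times> UNIV" by force
  ultimately show ?thesis by simp
qed

lemma I_up_minus_eq_I_down_plus:
  assumes S: "S \<in> carrier_mat m m" "transpose_mat S = S" and p: "p > 0"
    and X: "X \<in> triples m" and Y: "Y \<in> triples m" and \<alpha>0: "\<alpha>0 \<in> carrier_vec m"
    and cd: "int p dvd c" "int p dvd d"
    and nrm: "(\<lambda>x. norm (hecke_kernel S \<tau> p X Y c d x)) summable_on UNIV \<times> (+) \<alpha>0 ` int_vecs m \<times> UNIV"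
  shows "I_up_minus m S \<alpha>0 p \<tau> X Y c d
    = of_nat p * I_down_plus m S \<alpha>0 p \<tau> X Y (c div int p) (d div int p)"
proof -
  have "{l3. int p dvd d * l3} = UNIV" using cd by auto
  then show ?thesis
    using I_up_minus_eq_hecke_sum[OF S(1) p X Y \<alpha>0] I_down_plus_eq_infsum[OF S p X Y \<alpha>0 cd]
      hecke_sum_dvd[OF _ cd(1) nrm, of d] p by simp
qed

theorem theorem7p2:
  fixes m p :: nat and S :: "real mat" and \<alpha>0 :: "real vec"
    and \<tau> :: complex and X Y :: triple and c d :: int
  assumes "pos_def_even_integral m S"
    and "prime p"
    and "Im \<tau> > 0"
    and "\<alpha>0 \<in> S_inv_int_vecs m S"
    and "X \<in> triples m"
    and "Y \<in> Ycone m S"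
  shows "(\<not> int p dvd c \<or> \<not> int p dvd d \<longrightarrow>
            I_up_minus m S \<alpha>0 p \<tau> X Y c d = I_down_minus m S \<alpha>0 p \<tau> X Y c d)
       \<and> (int p dvd c \<and> int p dvd d \<longrightarrow>
            I_up_minus m S \<alpha>0 p \<tau> X Y c d =
              of_nat p * I_down_plus m S \<alpha>0 p \<tau> X Y (c div int p) (d div int p)
          \<and> I_down_minus m S \<alpha>0 p \<tau> X Y c d =
              of_nat p * I_up_plus m S \<alpha>0 p \<tau> X Y (c div int p) (d div int p))"
proof -
  note S = pos_def_even_integralD[OF assms(1)]
  have p: "p > 0" using assms(2) by (rule prime_gt_0_nat)
  have Y: "Y \<in> triples m" using assms(6) by (simp add: Ycone_def)
  have \<alpha>0: "\<alpha>0 \<in> carrier_vec m"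
    using assms(4) by (force simp: S_inv_int_vecs_def int_vecs_def)
  let ?H = "hecke_kernel S \<tau> p X Y c d" and ?V = "(+) \<alpha>0 ` int_vecs m"
  have nrm: "(\<lambda>x. norm (?H x)) summable_on UNIV \<times> ?V \<times> UNIV"
    using assms p by (intro abs_summable_hecke_kernel) auto
  \<comment> \<open>Summability is transported along the exchange; a direct proof would first have
    to place \<open>swap3 Y\<close> in the cone.\<close>
  have nrm': "(\<lambda>x. norm (hecke_kernel S \<tau> p (swap3 X) (swap3 Y) c d x)) summable_on UNIV \<times> ?V \<times> UNIV"
    unfolding hecke_kernel_swap3 o_def by (rule summable_on_swap3[OF nrm])
  \<comment> \<open>Statements about the series on the left become those on the right for exchanged
    \<open>X\<close> and \<open>Y\<close>, so the second identity of the divisible case follows from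
    the first.\<close>
  have down: "I_down_minus m S \<alpha>0 p \<tau> X Y c d = I_up_minus m S \<alpha>0 p \<tau> (swap3 X) (swap3 Y) c d"
    "I_up_plus m S \<alpha>0 p \<tau> X Y c' d' = I_down_plus m S \<alpha>0 p \<tau> (swap3 X) (swap3 Y) c' d'" for c' d'
    by (simp_all add: I_down_minus_swap3 [symmetric] I_up_plus_swap3 [symmetric])
  show ?thesis
  proof (intro conjI impI)
    assume "\<not> int p dvd c \<or> \<not> int p dvd d"
    with hecke_sum_swap[OF _ this nrm] assms(2)
    show "I_up_minus m S \<alpha>0 p \<tau> X Y c d = I_down_minus m S \<alpha>0 p \<tau> X Y c d"
      unfolding down by (simp add: I_up_minus_eq_hecke_sum S p assms(5) Y \<alpha>0 hecke_kernel_swap3)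
  next
    assume cd: "int p dvd c \<and> int p dvd d"
    show "I_up_minus m S \<alpha>0 p \<tau> X Y c d =
        of_nat p * I_down_plus m S \<alpha>0 p \<tau> X Y (c div int p) (d div int p)"
      using cd by (intro I_up_minus_eq_I_down_plus S p assms(5) Y \<alpha>0 nrm) auto
    show "I_down_minus m S \<alpha>0 p \<tau> X Y c d =
        of_nat p * I_up_plus m S \<alpha>0 p \<tau> X Y (c div int p) (d div int p)"
      unfolding down using cd assms(5) Y
      by (intro I_up_minus_eq_I_down_plus S p \<alpha>0 nrm') auto
  qed
qed

end
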